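(* Let $\mathcal{H}$ be a complex Hilbert space and let $T=\alpha T_0\in\mathcal{B}(\mathcal{H})$, where $\alpha\in\mathbb{R}$ and $T_0\in\mathcal{B}(\mathcal{H})$ is a partial isometry. If $T$ satisfies $|T|\le|\mathrm{Re}\,T|$, then $T$ is self-adjoint.
   Context: $\mathcal{B}(\mathcal{H})$ is the algebra of bounded linear operators on $\mathcal{H}$. For $T\in\mathcal{B}(\mathcal{H})$, $|T|=(T^*T)^{1/2}$ and $\mathrm{Re}\,T=\frac12(T+T^* )$; inequalities between self-adjoint operators are in the usual order. A partial isometry is an operator $T_0$ such that $T_0^*T_0$ is an orthogonal projection. *)

theory Defs
  imports "HOL-Analysis.Analysis"
begin

text \<open>
  A complex Hilbert space is a type: a real Banach space (possibly zero, of arbitrary dimension)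
  with a compatible complex scalar multiplication, whose norm comes from a complex inner product.
  The inner product is linear in its first argument.
\<close>

class complex_hilbert_space = banach +
  fixes scaleC :: "complex \<Rightarrow> 'a \<Rightarrow> 'a" (infixr "*\<^sub>C" 75)
    and cinner :: "'a \<Rightarrow> 'a \<Rightarrow> complex"
  assumes scaleC_add_right: "c *\<^sub>C (x + y) = c *\<^sub>C x + c *\<^sub>C y"
    and scaleC_add_left: "(c + d) *\<^sub>C x = c *\<^sub>C x + d *\<^sub>C x"
    and scaleC_scaleC: "c *\<^sub>C d *\<^sub>C x = (c * d) *\<^sub>C x"
    and scaleC_one: "1 *\<^sub>C x = x"
    and scaleR_scaleC: "r *\<^sub>R x = complex_of_real r *\<^sub>C x"
    and cinner_commute: "cinner x y = cnj (cinner y x)"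
    and cinner_add_left: "cinner (x + y) z = cinner x z + cinner y z"
    and cinner_scaleC_left: "cinner (c *\<^sub>C x) y = c * cinner x y"
    and cinner_self_nonneg: "cinner x x \<in> \<real>\<^sub>\<ge>\<^sub>0"
    and cinner_self_eq_0_iff: "cinner x x = 0 \<longleftrightarrow> x = 0"
    and norm_eq_sqrt_cinner: "norm x = sqrt (Re (cinner x x))"

instantiation complex :: complex_hilbert_space
begin

definition scaleC_complex :: "complex \<Rightarrow> complex \<Rightarrow> complex"
  where "scaleC_complex c x = c * x"

definition cinner_complex :: "complex \<Rightarrow> complex \<Rightarrow> complex"
  where "cinner_complex x y = x * cnj y"

instance
proof
  fix x :: complex
  show "cinner x x \<in> \<real>\<^sub>\<ge>\<^sub>0"
    by (simp add: cinner_complex_def complex_nonneg_Reals_iff)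
  show "norm x = sqrt (Re (cinner x x))"
    by (simp add: cinner_complex_def norm_complex_def power2_eq_square)
qed (simp_all add: scaleC_complex_def cinner_complex_def algebra_simps scaleR_conv_of_real)

end

definition bounded_clinear :: "('a::complex_hilbert_space \<Rightarrow> 'a) \<Rightarrow> bool"
  where "bounded_clinear T \<longleftrightarrow> bounded_linear T \<and> (\<forall>c x. T (c *\<^sub>C x) = c *\<^sub>C T x)"

text \<open>
  There is at most one function satisfying the adjoint equation; for a bounded operator it exists
  and is again a bounded operator, by the Riesz representation theorem.
\<close>

definition cadjoint :: "('a::complex_hilbert_space \<Rightarrow> 'a) \<Rightarrow> 'a \<Rightarrow> 'a"
  where "cadjoint T = (THE S. \<forall>x y. cinner (T x) y = cinner x (S y))"

definition selfadjoint_op :: "('a::complex_hilbert_space \<Rightarrow> 'a) \<Rightarrow> bool"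
  where "selfadjoint_op T \<longleftrightarrow> bounded_clinear T \<and> cadjoint T = T"

definition positive_op :: "('a::complex_hilbert_space \<Rightarrow> 'a) \<Rightarrow> bool"
  where "positive_op T \<longleftrightarrow> selfadjoint_op T \<and> (\<forall>x. cinner (T x) x \<in> \<real>\<^sub>\<ge>\<^sub>0)"

definition op_le :: "('a::complex_hilbert_space \<Rightarrow> 'a) \<Rightarrow> ('a \<Rightarrow> 'a) \<Rightarrow> bool"
  where "op_le A B \<longleftrightarrow> selfadjoint_op A \<and> selfadjoint_op B \<and> positive_op (\<lambda>x. B x - A x)"

text \<open>The square root is meaningful for positive operators only, where it exists uniquely.\<close>

definition op_sqrt :: "('a::complex_hilbert_space \<Rightarrow> 'a) \<Rightarrow> 'a \<Rightarrow> 'a"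
  where "op_sqrt A = (THE B. positive_op B \<and> B \<circ> B = A)"

definition op_abs :: "('a::complex_hilbert_space \<Rightarrow> 'a) \<Rightarrow> 'a \<Rightarrow> 'a"
  where "op_abs T = op_sqrt (cadjoint T \<circ> T)"

definition op_Re :: "('a::complex_hilbert_space \<Rightarrow> 'a) \<Rightarrow> 'a \<Rightarrow> 'a"
  where "op_Re T = (\<lambda>x. (1/2) *\<^sub>R (T x + cadjoint T x))"

definition orthogonal_projection :: "('a::complex_hilbert_space \<Rightarrow> 'a) \<Rightarrow> bool"
  where "orthogonal_projection P \<longleftrightarrow> selfadjoint_op P \<and> P \<circ> P = P"

definition partial_isometry :: "('a::complex_hilbert_space \<Rightarrow> 'a) \<Rightarrow> bool"
  where "partial_isometry V \<longleftrightarrow> bounded_clinear V \<and> orthogonal_projection (cadjoint V \<circ> V)"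

end

theory Submission imports Defs begin

text \<open>
  Let \<open>P = T0\<^sup>* T0\<close>, so that \<open>|T| = |\<alpha>| P\<close>. For \<open>x\<close> in the range of \<open>P\<close> the hypothesis and the
  Cauchy-Schwarz inequality give \<open>|\<alpha>| \<parallel>x\<parallel> \<le> \<parallel>Re T x\<parallel>\<close>. As \<open>T0\<close> and its adjoint are contractions,
  strict convexity of the norm forces \<open>T0 x = T0\<^sup>* x\<close> if \<open>\<alpha> \<noteq> 0\<close>. Hence \<open>T0 = T0\<^sup>* P\<close>; taking adjoints,
  \<open>T0\<^sup>* = P T0 = P T0 P = T0\<^sup>* P = T0\<close>.
\<close>

section \<open>The complex inner product\<close>

lemma cinner_add_right: "cinner x (y + z) = cinner x y + cinner x z"
  for x y z :: "'a::complex_hilbert_space"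
  by (metis cinner_add_left cinner_commute complex_cnj_add)

lemma cinner_scaleC_right: "cinner x (c *\<^sub>C y) = cnj c * cinner x y"
  for x y :: "'a::complex_hilbert_space"
  by (metis cinner_commute cinner_scaleC_left complex_cnj_mult)

lemma cinner_scaleR_left: "cinner (r *\<^sub>R x) y = complex_of_real r * cinner x y"
  for x y :: "'a::complex_hilbert_space"
  by (simp add: scaleR_scaleC cinner_scaleC_left)

lemma cinner_scaleR_right: "cinner x (r *\<^sub>R y) = complex_of_real r * cinner x y"
  for x y :: "'a::complex_hilbert_space"
  by (simp add: scaleR_scaleC cinner_scaleC_right)

lemma cinner_zero_left: "cinner 0 y = 0" for y :: "'a::complex_hilbert_space"
  using cinner_scaleR_left[of 0 0 y] by simp

lemma cinner_zero_right: "cinner y 0 = 0" for y :: "'a::complex_hilbert_space"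
  using cinner_scaleR_right[of y 0 0] by simp

lemma cinner_minus_left: "cinner (- x) y = - cinner x y" for x y :: "'a::complex_hilbert_space"
  using cinner_scaleR_left[of "-1" x y] by simp

lemma cinner_minus_right: "cinner x (- y) = - cinner x y" for x y :: "'a::complex_hilbert_space"
  using cinner_scaleR_right[of x "-1" y] by simp

lemma cinner_diff_left: "cinner (x - y) z = cinner x z - cinner y z"
  for x y z :: "'a::complex_hilbert_space"
  using cinner_add_left[of x "- y" z] by (simp add: cinner_minus_left)

lemma cinner_diff_right: "cinner x (y - z) = cinner x y - cinner x z"
  for x y z :: "'a::complex_hilbert_space"
  using cinner_add_right[of x y "- z"] by (simp add: cinner_minus_right)

lemmas cinner_simps = cinner_add_left cinner_add_right cinner_diff_left cinner_diff_right
  cinner_minus_left cinner_minus_right cinner_scaleR_left cinner_scaleR_right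
  cinner_scaleC_left cinner_scaleC_right cinner_zero_left cinner_zero_right

lemma cinner_self: "cinner x x = complex_of_real ((norm x)\<^sup>2)"
  for x :: "'a::complex_hilbert_space"
proof -
  have "cinner x x \<in> \<real>\<^sub>\<ge>\<^sub>0" by (rule cinner_self_nonneg)
  then show ?thesis
    by (auto simp: norm_eq_sqrt_cinner complex_nonneg_Reals_iff complex_eq_iff)
qed

lemma Re_cinner_commute: "Re (cinner x y) = Re (cinner y x)"
  for x y :: "'a::complex_hilbert_space"
  by (subst cinner_commute) simp

text \<open>Definiteness at the test vector \<open>z = x - y\<close>. Identities between adjoints
  are proved through this form.\<close>

lemma cinner_left_eqI:
  fixes x y :: "'a::complex_hilbert_space"
  assumes "\<And>z. cinner z x = cinner z y"
  shows "x = y"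
  using cinner_self_eq_0_iff[of "x - y"] assms[of "x - y"] by (simp add: cinner_diff_right)

lemma norm_add_sq: "(norm (x + y))\<^sup>2 = (norm x)\<^sup>2 + (norm y)\<^sup>2 + 2 * Re (cinner x y)"
  for x y :: "'a::complex_hilbert_space"
proof -
  have "Re (cinner (x + y) (x + y)) = Re (cinner x x) + Re (cinner y y) + 2 * Re (cinner x y)"
    using Re_cinner_commute[of x y] by (simp add: cinner_simps)
  then show ?thesis by (simp add: cinner_self)
qed

lemma norm_diff_sq: "(norm (x - y))\<^sup>2 = (norm x)\<^sup>2 + (norm y)\<^sup>2 - 2 * Re (cinner x y)"
  for x y :: "'a::complex_hilbert_space"
  using norm_add_sq[of x "- y"] by (simp add: cinner_simps)

lemma parallelogram_law:
  "(norm (x + y))\<^sup>2 + (norm (x - y))\<^sup>2 = 2 * (norm x)\<^sup>2 + 2 * (norm y)\<^sup>2"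
  for x y :: "'a::complex_hilbert_space"
  by (simp add: norm_add_sq norm_diff_sq)

lemma norm_scaleC: "norm (c *\<^sub>C x) = cmod c * norm x" for x :: "'a::complex_hilbert_space"
proof -
  have "complex_of_real ((norm (c *\<^sub>C x))\<^sup>2) = complex_of_real ((cmod c * norm x)\<^sup>2)"
    unfolding cinner_self[symmetric] cinner_scaleC_left cinner_scaleC_right
    using complex_norm_square[of c]
    by (simp add: cinner_self power_mult_distrib flip: mult.assoc)
  then have "(norm (c *\<^sub>C x))\<^sup>2 = (cmod c * norm x)\<^sup>2"
    by (simp only: of_real_eq_iff)
  then show ?thesis by (simp add: power2_eq_iff_nonneg)
qed

text \<open>Cauchy-Schwarz, from the nonnegative squared norm of a multiple of the component of
  \<open>x\<close> orthogonal to \<open>y\<close>.\<close>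

lemma cmod_cinner_le: "cmod (cinner x y) \<le> norm x * norm y" for x y :: "'a::complex_hilbert_space"
proof (cases "y = 0")
  case False
  define n where "n = (norm y)\<^sup>2"
  define a where "a = cinner x y"
  have n: "n > 0" using False by (simp add: n_def)
  have yx: "cinner y x = cnj a" unfolding a_def by (rule cinner_commute)
  have yy: "cinner y y = complex_of_real n" unfolding n_def by (rule cinner_self)
  \<comment> \<open>The orthogonal component \<open>x - (a / n) y\<close>, multiplied by
    \<open>n\<close> to avoid the division.\<close>
  let ?v = "n *\<^sub>R x - a *\<^sub>C y"
  have "cinner ?v ?v = complex_of_real n * (complex_of_real n * cinner x x - a * cnj a)"
    by (simp add: cinner_simps yx yy a_def[symmetric] algebra_simps)
  also have "\<dots> = complex_of_real (n * (n * (norm x)\<^sup>2 - (cmod a)\<^sup>2))"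
    by (simp add: cinner_self complex_norm_square[symmetric] del: of_real_power)
  finally have "complex_of_real ((norm ?v)\<^sup>2)
      = complex_of_real (n * (n * (norm x)\<^sup>2 - (cmod a)\<^sup>2))"
    by (simp only: cinner_self)
  then have "n * (n * (norm x)\<^sup>2 - (cmod a)\<^sup>2) \<ge> 0"
    by (metis of_real_eq_iff zero_le_power2)
  then have "(cmod a)\<^sup>2 \<le> (norm x * norm y)\<^sup>2"
    using n by (simp add: zero_le_mult_iff power_mult_distrib n_def mult.commute)
  then show ?thesis
    unfolding a_def by (rule power2_le_imp_le) simp
qed (simp add: cinner_zero_right)

lemma Re_cinner_le: "Re (cinner x y) \<le> norm x * norm y" for x y :: "'a::complex_hilbert_space"
  using cmod_cinner_le[of x y] complex_Re_le_cmod[of "cinner x y"] by linarith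

text \<open>Provides continuity in the first argument, so that limits pass through the inner
  product.\<close>

lemma bounded_linear_cinner_left: "bounded_linear (\<lambda>x. cinner x y)"
  for y :: "'a::complex_hilbert_space"
  by (rule bounded_linear_intro[where K = "norm y"])
    (simp_all add: cinner_simps scaleR_conv_of_real cmod_cinner_le)

lemma bounded_linear_scaleC: "bounded_linear (\<lambda>x::'a::complex_hilbert_space. c *\<^sub>C x)"
  by (rule bounded_linear_intro[where K = "cmod c"])
    (simp_all add: scaleC_add_right scaleR_scaleC scaleC_scaleC norm_scaleC mult.commute)

lemma scaleC_right_diff_distrib: "c *\<^sub>C (x - y) = c *\<^sub>C x - c *\<^sub>C y"
  for x y :: "'a::complex_hilbert_space"
  using bounded_linear_scaleC by (rule linear_diff[OF bounded_linear.linear])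

lemma scaleC_scaleR_commute: "c *\<^sub>C r *\<^sub>R x = r *\<^sub>R c *\<^sub>C x"
  for x :: "'a::complex_hilbert_space"
  by (simp add: scaleR_scaleC scaleC_scaleC mult.commute)

section \<open>Adjoints\<close>

text \<open>The representing vector minimises \<open>\<parallel>x\<parallel>\<^sup>2 - 2 Re (f x)\<close>; by the parallelogram law every
  minimising sequence is Cauchy.\<close>

lemma riesz_real:
  fixes f :: "'a::complex_hilbert_space \<Rightarrow> real"
  assumes f: "bounded_linear f"
  shows "\<exists>z. \<forall>x. f x = Re (cinner x z)"
proof -
  interpret f: bounded_linear f by (rule f)
  define g where "g x = (norm x)\<^sup>2 - 2 * f x" for x
  obtain K where K: "\<And>x. norm (f x) \<le> norm x * K" using f.bounded by blast
  \<comment> \<open>Completing the square: \<open>g x\<close> is at least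
    \<open>(norm x - K)\<^sup>2 - K\<^sup>2\<close>.\<close>
  have bound: "- K\<^sup>2 \<le> g x" for x
  proof -
    have "f x \<le> norm x * K" using K[of x] by simp
    moreover have "0 \<le> (norm x - K)\<^sup>2" by simp
    ultimately show ?thesis unfolding g_def power2_diff by linarith
  qed
  define m where "m = (INF x. g x)"
  have bdd: "bdd_below (range g)" using bound by (intro bdd_belowI[of _ "- K\<^sup>2"]) auto
  have m_le: "m \<le> g x" for x unfolding m_def by (rule cINF_lower[OF bdd]) simp
  have "\<exists>x. g x < m + 1 / real (Suc n)" for n
    using cINF_less_iff[OF _ bdd, of "m + 1 / real (Suc n)"] unfolding m_def by simp
  then obtain X where X: "\<And>n. g (X n) < m + 1 / real (Suc n)" by metis
  \<comment> \<open>Compare \<open>m\<close> with the value of \<open>g\<close> at the midpoint of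
    \<open>x\<close> and \<open>y\<close>, then apply the parallelogram law.\<close>
  have dist_sq: "(norm (x - y))\<^sup>2 \<le> 2 * (g x - m) + 2 * (g y - m)" for x y
  proof -
    have half: "(norm ((1/2) *\<^sub>R (x + y)))\<^sup>2 = (norm (x + y))\<^sup>2 / 4"
      unfolding norm_scaleR by (simp add: power_divide)
    have "4 * m \<le> 4 * g ((1/2) *\<^sub>R (x + y))" using m_le by simp
    also have "\<dots> = (norm (x + y))\<^sup>2 - 4 * f x - 4 * f y"
      unfolding g_def half by (simp add: f.scaleR f.add field_simps)
    finally show ?thesis using parallelogram_law[of x y] by (simp add: g_def)
  qed
  have "Cauchy X"
  proof (rule metric_CauchyI)
    fix e :: real assume e: "e > 0"
    \<comment> \<open>The bound \<open>dist_sq\<close> adds two gaps \<open>g - m\<close>, each with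
      factor 2; four quarters of \<open>e\<^sup>2\<close> give \<open>e\<^sup>2\<close>.\<close>
    obtain N where N: "inverse (real (Suc N)) < e\<^sup>2 / 4"
      using reals_Archimedean[of "e\<^sup>2 / 4"] e by auto
    have small: "g (X n) - m < e\<^sup>2 / 4" if "n \<ge> N" for n
    proof -
      have "1 / real (Suc n) \<le> 1 / real (Suc N)" using that by (intro divide_left_mono) auto
      then show ?thesis using X[of n] N by (simp add: inverse_eq_divide)
    qed
    show "\<exists>N. \<forall>i\<ge>N. \<forall>j\<ge>N. dist (X i) (X j) < e"
    proof (intro exI allI impI)
      fix i j assume ij: "i \<ge> N" "j \<ge> N"
      have "(norm (X i - X j))\<^sup>2 \<le> 2 * (g (X i) - m) + 2 * (g (X j) - m)"
        by (rule dist_sq)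
      also have "\<dots> < 2 * (e\<^sup>2 / 4) + 2 * (e\<^sup>2 / 4)"
        using small[OF ij(1)] small[OF ij(2)] by simp
      also have "\<dots> = e\<^sup>2" by simp
      finally show "dist (X i) (X j) < e"
        using e by (simp add: dist_norm power2_less_imp_less)
    qed
  qed
  then obtain z where z: "X \<longlonglongrightarrow> z" using Cauchy_convergent convergent_def by blast
  have "(\<lambda>n. g (X n)) \<longlonglongrightarrow> g z"
    unfolding g_def by (intro tendsto_intros z f.tendsto)
  moreover have "(\<lambda>n. m + 1 / real (Suc n)) \<longlonglongrightarrow> m + 0"
    by (intro tendsto_intros LIMSEQ_Suc lim_1_over_n)
  ultimately have gz: "g z \<le> m + 0"
    by (rule LIMSEQ_le) (use X less_imp_le in blast)
  have "f h = Re (cinner h z)" for h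
  proof (rule ccontr)
    assume ne: "f h \<noteq> Re (cinner h z)"
    define d where "d = f h - Re (cinner h z)"
    \<comment> \<open>First variation: minimality of \<open>z\<close> against \<open>z + t h\<close>
      leaves a quadratic inequality in \<open>t\<close>, which can hold for all \<open>t\<close>
      only if its linear coefficient \<open>d\<close> vanishes.\<close>
    have ineq: "2 * (t * d) \<le> t\<^sup>2 * (norm h)\<^sup>2" for t
    proof -
      have "g z \<le> g (z + t *\<^sub>R h)" using gz m_le[of "z + t *\<^sub>R h"] by linarith
      then show ?thesis
        using Re_cinner_commute[of z h]
        by (simp add: g_def d_def norm_add_sq f.add f.scaleR cinner_simps power_mult_distrib algebra_simps)
    qed
    \<comment> \<open>The summand 1 keeps \<open>b\<close> positive for \<open>h = 0\<close>. At
      \<open>t = d / b\<close> the inequality yields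
      \<open>2 d\<^sup>2 / b \<le> d\<^sup>2 / b\<close>, which is impossible for nonzero
      \<open>d\<close>.\<close>
    define b where "b = (norm h)\<^sup>2 + 1"
    have b: "b > 0" unfolding b_def by (simp add: add_nonneg_pos)
    have "2 * (d / b * d) \<le> (d / b)\<^sup>2 * (norm h)\<^sup>2" by (rule ineq)
    also have "\<dots> \<le> (d / b)\<^sup>2 * b" by (intro mult_left_mono) (auto simp: b_def)
    also have "\<dots> = d / b * d" using b by (simp add: power2_eq_square)
    finally have "d * d / b \<le> 0" by simp
    moreover have "d * d / b > 0"
      using ne b by (intro divide_pos_pos) (auto simp: d_def zero_less_mult_iff)
    ultimately show False by linarith
  qed
  then show ?thesis by blast
qed

section \<open>The adjoint of a bounded operator\<close>

lemma bounded_clinear_scaleC: "bounded_clinear T \<Longrightarrow> T (c *\<^sub>C x) = c *\<^sub>C T x"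
  by (simp add: bounded_clinear_def)

lemma bounded_clinear_bounded_linear: "bounded_clinear T \<Longrightarrow> bounded_linear T"
  by (simp add: bounded_clinear_def)

lemma bounded_clinear_linear: "bounded_clinear T \<Longrightarrow> linear T"
  by (simp add: bounded_clinear_def bounded_linear.linear)

text \<open>For fixed \<open>y\<close>, Riesz represents the real functional
  \<open>Re (cinner (T x) y)\<close>. Replacing \<open>x\<close> by \<open>\<i> *\<^sub>C x\<close>
  and using complex linearity recovers the imaginary part.\<close>

lemma adjoint_exists:
  fixes T :: "'a::complex_hilbert_space \<Rightarrow> 'a"
  assumes T: "bounded_clinear T"
  shows "\<exists>S. \<forall>x y. cinner (T x) y = cinner x (S y)"
proof -
  have "\<exists>z. \<forall>x. cinner (T x) y = cinner x z" for y
  proof -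
    have "bounded_linear (\<lambda>x. Re (cinner (T x) y))"
      by (intro bounded_linear_compose[OF bounded_linear_Re]
          bounded_linear_compose[OF bounded_linear_cinner_left] bounded_clinear_bounded_linear T)
    then obtain z where z: "\<And>x. Re (cinner (T x) y) = Re (cinner x z)"
      using riesz_real by blast
    have "cinner (T x) y = cinner x z" for x
      using z[of x] z[of "\<i> *\<^sub>C x"]
      by (simp add: bounded_clinear_scaleC[OF T] cinner_scaleC_left complex_eq_iff)
    then show ?thesis by blast
  qed
  then show ?thesis by metis
qed

text \<open>Two solutions of the adjoint equation agree against every vector, so any solution at
  hand is the value of the \<open>THE\<close> in \<open>cadjoint\<close>.\<close>

lemma cadjoint_eqI:
  fixes T :: "'a::complex_hilbert_space \<Rightarrow> 'a"
  assumes "\<And>x y. cinner (T x) y = cinner x (S y)"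
  shows "cadjoint T = S"
  unfolding cadjoint_def
proof (rule the_equality)
  fix S' assume "\<forall>x y. cinner (T x) y = cinner x (S' y)"
  then have "cinner x (S' y) = cinner x (S y)" for x y by (simp flip: assms)
  then show "S' = S" by (intro ext) (rule cinner_left_eqI)
qed (simp add: assms)

lemma cinner_cadjoint:
  fixes T :: "'a::complex_hilbert_space \<Rightarrow> 'a"
  assumes "bounded_clinear T"
  shows "cinner (T x) y = cinner x (cadjoint T y)"
proof -
  obtain S where S: "\<And>x y. cinner (T x) y = cinner x (S y)"
    using adjoint_exists[OF assms] by blast
  then have "cadjoint T = S" by (rule cadjoint_eqI)
  then show ?thesis by (simp add: S)
qed

lemma cinner_cadjoint':
  fixes T :: "'a::complex_hilbert_space \<Rightarrow> 'a"
  assumes "bounded_clinear T"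
  shows "cinner (cadjoint T x) y = cinner x (T y)"
  using cinner_cadjoint[OF assms, of y x] by (subst (1 2) cinner_commute) simp

text \<open>With \<open>z = cadjoint T y\<close>, the square of \<open>norm z\<close> is
  \<open>cinner (T z) y\<close>, at most \<open>K * norm z * norm y\<close>; then
  \<open>norm z\<close> cancels.\<close>

lemma norm_cadjoint_le:
  fixes T :: "'a::complex_hilbert_space \<Rightarrow> 'a"
  assumes T: "bounded_clinear T" and K: "\<And>x. norm (T x) \<le> K * norm x"
  shows "norm (cadjoint T y) \<le> K * norm y"
proof (cases "cadjoint T y = 0")
  case True
  \<comment> \<open>The sign of \<open>K\<close> is not given; \<open>0 \<le> K * norm y\<close>
    follows from the bound on \<open>norm (T y)\<close>.\<close>
  then show ?thesis using order_trans[OF norm_ge_zero K[of y]] by simp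
next
  case False
  let ?z = "cadjoint T y"
  have "(norm ?z)\<^sup>2 = Re (cinner (T ?z) y)"
    by (simp add: cinner_cadjoint[OF T] cinner_self)
  also have "\<dots> \<le> norm (T ?z) * norm y" by (rule Re_cinner_le)
  also have "\<dots> \<le> (K * norm ?z) * norm y" by (intro mult_right_mono K) simp
  finally have "norm ?z * norm ?z \<le> norm ?z * (K * norm y)"
    by (simp add: power2_eq_square mult_ac)
  then show ?thesis using False by simp
qed

lemma bounded_clinear_cadjoint:
  fixes T :: "'a::complex_hilbert_space \<Rightarrow> 'a"
  assumes T: "bounded_clinear T"
  shows "bounded_clinear (cadjoint T)"
proof -
  obtain K where K: "\<And>x. norm (T x) \<le> K * norm x"
    using bounded_linear.bounded[OF bounded_clinear_bounded_linear[OF T]] by (auto simp: mult.commute)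
  have c: "cadjoint T (c *\<^sub>C x) = c *\<^sub>C cadjoint T x" for c x
    by (rule cinner_left_eqI) (simp add: cinner_scaleC_right flip: cinner_cadjoint[OF T])
  have "bounded_linear (cadjoint T)"
  proof (rule bounded_linear_intro[where K = K])
    show "cadjoint T (x + y) = cadjoint T x + cadjoint T y" for x y
      by (rule cinner_left_eqI) (simp add: cinner_add_right flip: cinner_cadjoint[OF T])
    show "cadjoint T (r *\<^sub>R x) = r *\<^sub>R cadjoint T x" for r x
      by (simp add: scaleR_scaleC c)
    show "norm (cadjoint T x) \<le> norm x * K" for x
      using norm_cadjoint_le[OF T K] by (simp add: mult.commute)
  qed
  with c show ?thesis by (simp add: bounded_clinear_def)
qed

section \<open>Self-adjoint and positive operators\<close>

lemma bounded_clinear_compose: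
  "bounded_clinear S \<Longrightarrow> bounded_clinear T \<Longrightarrow> bounded_clinear (S \<circ> T)"
  unfolding bounded_clinear_def comp_def using bounded_linear_compose by auto

lemma bounded_clinear_scaleR:
  "bounded_clinear T \<Longrightarrow> bounded_clinear (\<lambda>x. r *\<^sub>R T x)"
  unfolding bounded_clinear_def
  using bounded_linear_compose[OF bounded_linear_scaleR_right]
  by (auto simp: scaleC_scaleR_commute)

lemma selfadjoint_op_iff:
  "selfadjoint_op T \<longleftrightarrow> bounded_clinear T \<and> (\<forall>x y. cinner (T x) y = cinner x (T y))"
  unfolding selfadjoint_op_def using cinner_cadjoint[of T] cadjoint_eqI[of T T] by auto

lemma selfadjoint_op_cinner: "selfadjoint_op T \<Longrightarrow> cinner (T x) y = cinner x (T y)"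
  by (simp add: selfadjoint_op_iff)

lemma selfadjoint_op_cinner_self_real: "selfadjoint_op T \<Longrightarrow> cinner (T x) x \<in> \<real>"
  by (metis Reals_cnj_iff cinner_commute selfadjoint_op_cinner)

text \<open>The quadratic form of a self-adjoint operator is real, so only the sign of its real part
  remains to be tested.\<close>

lemma positive_op_iff: "positive_op T \<longleftrightarrow> selfadjoint_op T \<and> (\<forall>x. 0 \<le> Re (cinner (T x) x))"
proof -
  have "cinner (T x) x \<in> \<real>\<^sub>\<ge>\<^sub>0 \<longleftrightarrow> 0 \<le> Re (cinner (T x) x)" if "selfadjoint_op T" for x
    using selfadjoint_op_cinner_self_real[OF that, of x]
    by (simp add: complex_nonneg_Reals_iff complex_is_Real_iff)
  then show ?thesis unfolding positive_op_def by blast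
qed

lemma positive_op_scaleR:
  assumes "positive_op T" "0 \<le> r"
  shows "positive_op (\<lambda>x. r *\<^sub>R T x)"
  using assms
  by (auto simp: positive_op_iff selfadjoint_op_iff bounded_clinear_scaleR cinner_simps)

lemma selfadjoint_op_Re:
  assumes T: "bounded_clinear T"
  shows "selfadjoint_op (op_Re T)"
proof -
  have "bounded_linear (op_Re T)"
    unfolding op_Re_def
    by (intro bounded_linear_compose[OF bounded_linear_scaleR_right] bounded_linear_add
        bounded_clinear_bounded_linear bounded_clinear_cadjoint T)
  moreover have "op_Re T (c *\<^sub>C x) = c *\<^sub>C op_Re T x" for c x
    by (simp add: op_Re_def bounded_clinear_scaleC T bounded_clinear_cadjoint
        scaleC_scaleR_commute scaleC_add_right)
  ultimately have "bounded_clinear (op_Re T)" by (simp add: bounded_clinear_def)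
  then show ?thesis
    using cinner_cadjoint[OF T] cinner_cadjoint'[OF T]
    by (simp add: selfadjoint_op_iff op_Re_def cinner_simps add.commute)
qed

lemma positive_op_cadjoint_comp:
  assumes T: "bounded_clinear T"
  shows "positive_op (cadjoint T \<circ> T)"
  using bounded_clinear_compose[OF bounded_clinear_cadjoint[OF T] T]
  by (simp add: positive_op_iff selfadjoint_op_iff cinner_cadjoint[OF T, symmetric]
      cinner_cadjoint'[OF T] cinner_self)

section \<open>Square roots of positive operators\<close>

text \<open>Positivity is tested at \<open>x - (1/K) A x\<close>, where the cross terms produce the
  square of \<open>norm (A x)\<close> and the bound \<open>K\<close> controls the remaining
  term.\<close>

lemma positive_op_norm_sq_le:
  assumes A: "positive_op A" and K: "\<And>x. norm (A x) \<le> K * norm x" "0 < K"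
  shows "(norm (A x))\<^sup>2 \<le> K * Re (cinner (A x) x)"
proof -
  have sa: "selfadjoint_op A" using A by (simp add: positive_op_iff)
  have l: "linear A" using sa by (simp add: selfadjoint_op_iff bounded_clinear_linear)
  define y where "y = A x"
  have "Re (cinner (A y) y) \<le> norm (A y) * norm y" by (rule Re_cinner_le)
  also have "\<dots> \<le> (K * norm y) * norm y" by (intro mult_right_mono K) simp
  finally have y: "Re (cinner (A y) y) \<le> K * (norm y)\<^sup>2" by (simp add: power2_eq_square)
  have "0 \<le> Re (cinner (A (x - (1/K) *\<^sub>R y)) (x - (1/K) *\<^sub>R y))"
    using A by (simp add: positive_op_iff)
  also have "\<dots> = Re (cinner y x) - 2 / K * (norm y)\<^sup>2 + Re (cinner (A y) y) / K\<^sup>2"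
  proof -
    have "cinner (A y) x = cinner y y" by (simp add: selfadjoint_op_cinner[OF sa] y_def)
    then show ?thesis
      using K(2)
      by (simp add: linear_diff[OF l] linear_scale[OF l] cinner_simps cinner_self flip: y_def)
        (simp add: field_simps power2_eq_square)
  qed
  also have "\<dots> \<le> Re (cinner y x) - 2 / K * (norm y)\<^sup>2 + (K * (norm y)\<^sup>2) / K\<^sup>2"
    using y by (intro add_left_mono divide_right_mono) auto
  also have "\<dots> = Re (cinner y x) - (norm y)\<^sup>2 / K"
    using K(2) by (simp add: field_simps power2_eq_square)
  finally show ?thesis using K(2) by (simp add: y_def field_simps)
qed

lemma positive_op_pos_bounded:
  assumes "positive_op A"
  obtains K where "0 < K" "\<And>x. norm (A x) \<le> K * norm x"
  using assms bounded_linear.pos_bounded[of A]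
  by (auto simp: positive_op_iff selfadjoint_op_iff bounded_clinear_def mult.commute)

text \<open>The preceding estimate with right-hand side 0. Uniqueness of the square root uses it to
  pass from vanishing forms to vanishing vectors.\<close>

lemma positive_op_eq_0:
  assumes "positive_op A" "Re (cinner (A x) x) = 0"
  shows "A x = 0"
proof -
  obtain K where "0 < K" "\<And>x. norm (A x) \<le> K * norm x" using positive_op_pos_bounded assms by blast
  then show ?thesis using positive_op_norm_sq_le[OF assms(1), of K x] assms(2) by simp
qed

text \<open>With \<open>C = 1 - A\<close>, a limit \<open>Y\<close> of this iteration satisfies \<open>2 Y = C + Y\<^sup>2\<close>, that is
  \<open>(1 - Y)\<^sup>2 = A\<close>. The scalar iteration for \<open>C = 1\<close> is bounded and increasing, and its increments
  dominate those of the operator iteration when \<open>\<parallel>C\<parallel> \<le> 1\<close>, which gives convergence.\<close>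

primrec sqrt_iter :: "('a::real_vector \<Rightarrow> 'a) \<Rightarrow> nat \<Rightarrow> 'a \<Rightarrow> 'a" where
  "sqrt_iter C 0 x = 0"
| "sqrt_iter C (Suc n) x = (1/2) *\<^sub>R (C x + sqrt_iter C n (sqrt_iter C n x))"

primrec sqrt_bound :: "nat \<Rightarrow> real" where
  "sqrt_bound 0 = 0"
| "sqrt_bound (Suc n) = (1 + (sqrt_bound n)\<^sup>2) / 2"

lemma sqrt_bound_range: "0 \<le> sqrt_bound n \<and> sqrt_bound n \<le> 1"
  by (induction n) (auto simp: power_le_one)

lemma sqrt_bound_mono: "mono sqrt_bound"
proof (rule incseq_SucI)
  fix n
  \<comment> \<open>The increment of the scalar iteration is exactly half this square.\<close>
  have "0 \<le> (sqrt_bound n - 1)\<^sup>2" by simp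
  then show "sqrt_bound n \<le> sqrt_bound (Suc n)" unfolding power2_diff by simp
qed

lemma sqrt_iter_linear:
  assumes "linear C" shows "linear (sqrt_iter C n)"
proof (induction n)
  case 0
  then show ?case by (auto intro!: linearI)
next
  case (Suc n)
  then show ?case using assms
    by (auto intro!: linearI simp: linear_add linear_scale algebra_simps)
qed

text \<open>The iterates are built from \<open>C\<close> by sums, real multiples and compositions,
  all compatible with a linear \<open>B\<close> that commutes with \<open>C\<close>.\<close>

lemma sqrt_iter_commute:
  assumes "linear B" "\<And>x. B (C x) = C (B x)"
  shows "B (sqrt_iter C n x) = sqrt_iter C n (B x)"
  using assms by (induction n arbitrary: x) (simp_all add: linear_0 linear_add linear_scale)

lemma sqrt_iter_cinner:
  fixes C :: "'a::complex_hilbert_space \<Rightarrow> 'a"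
  assumes "\<And>x y. cinner (C x) y = cinner x (C y)"
  shows "cinner (sqrt_iter C n x) y = cinner x (sqrt_iter C n y)"
  using assms by (induction n arbitrary: x y) (simp_all add: cinner_simps)

lemma sqrt_iter_norm_le:
  fixes C :: "'a::real_normed_vector \<Rightarrow> 'a"
  assumes "\<And>x. norm (C x) \<le> norm x"
  shows "norm (sqrt_iter C n x) \<le> sqrt_bound n * norm x"
proof (induction n arbitrary: x)
  case (Suc n)
  have "norm (sqrt_iter C n (sqrt_iter C n x)) \<le> sqrt_bound n * norm (sqrt_iter C n x)"
    by (rule Suc)
  also have "\<dots> \<le> sqrt_bound n * (sqrt_bound n * norm x)"
    by (intro mult_left_mono Suc) (simp add: sqrt_bound_range)
  finally have "norm (C x + sqrt_iter C n (sqrt_iter C n x))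
      \<le> norm x + sqrt_bound n * (sqrt_bound n * norm x)"
    by (intro norm_triangle_mono assms)
  then show ?case
    unfolding sqrt_iter.simps sqrt_bound.simps norm_scaleR
    by (simp add: algebra_simps power2_eq_square)
qed simp

lemma sqrt_iter_norm_diff_Suc:
  fixes C :: "'a::real_normed_vector \<Rightarrow> 'a"
  assumes C: "linear C" "\<And>x. norm (C x) \<le> norm x"
  shows "norm (sqrt_iter C (Suc n) x - sqrt_iter C n x)
    \<le> (sqrt_bound (Suc n) - sqrt_bound n) * norm x"
proof (induction n arbitrary: x)
  case 0
  then show ?case using C by simp
next
  case (Suc n)
  let ?Y = "sqrt_iter C n" and ?Z = "sqrt_iter C (Suc n)"
  let ?y = "sqrt_bound n" and ?z = "sqrt_bound (Suc n)"
  have lin: "linear ?Z" by (rule sqrt_iter_linear[OF C(1)])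
  \<comment> \<open>Difference of squares as \<open>Z (Z - Y) + (Z - Y) Y\<close>: each summand has
    one factor bounded by the induction hypothesis and one by
    \<open>sqrt_iter_norm_le\<close>.\<close>
  have "?Z (?Z x) - ?Y (?Y x) = ?Z (?Z x - ?Y x) + (?Z (?Y x) - ?Y (?Y x))"
    by (simp only: linear_diff[OF lin]) simp
  then have "norm (?Z (?Z x) - ?Y (?Y x)) \<le> norm (?Z (?Z x - ?Y x)) + norm (?Z (?Y x) - ?Y (?Y x))"
    by (simp only: norm_triangle_ineq)
  also have "\<dots> \<le> ?z * ((?z - ?y) * norm x) + (?z - ?y) * (?y * norm x)"
  proof (rule add_mono)
    have "norm (?Z (?Z x - ?Y x)) \<le> ?z * norm (?Z x - ?Y x)"
      by (rule sqrt_iter_norm_le[OF C(2)])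
    also have "\<dots> \<le> ?z * ((?z - ?y) * norm x)"
      by (intro mult_left_mono Suc) (simp add: sqrt_bound_range del: sqrt_bound.simps)
    finally show "norm (?Z (?Z x - ?Y x)) \<le> ?z * ((?z - ?y) * norm x)" .
    have "norm (?Z (?Y x) - ?Y (?Y x)) \<le> (?z - ?y) * norm (?Y x)" by (rule Suc)
    also have "\<dots> \<le> (?z - ?y) * (?y * norm x)"
      by (intro mult_left_mono sqrt_iter_norm_le[OF C(2)])
        (use sqrt_bound_mono in \<open>simp add: incseq_SucD del: sqrt_bound.simps\<close>)
    finally show "norm (?Z (?Y x) - ?Y (?Y x)) \<le> (?z - ?y) * (?y * norm x)" .
  qed
  also have "\<dots> = (?z\<^sup>2 - ?y\<^sup>2) * norm x"
    by (simp add: algebra_simps power2_eq_square del: sqrt_bound.simps)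
  finally have *: "norm (?Z (?Z x) - ?Y (?Y x)) \<le> (?z\<^sup>2 - ?y\<^sup>2) * norm x" .
  \<comment> \<open>In consecutive iterates the summand \<open>C x\<close> cancels, leaving half a
    difference of squares; the scalar sequence behaves alike.\<close>
  have "sqrt_iter C (Suc (Suc n)) x - ?Z x = (1/2) *\<^sub>R (?Z (?Z x) - ?Y (?Y x))"
    unfolding sqrt_iter.simps(2)[of C "Suc n" x]
    by (subst (3) sqrt_iter.simps(2)) (simp only: scaleR_diff_right[symmetric] add_diff_cancel_left)
  moreover have "sqrt_bound (Suc (Suc n)) - ?z = (?z\<^sup>2 - ?y\<^sup>2) / 2"
    unfolding sqrt_bound.simps(2)[of "Suc n"]
    by (subst (2) sqrt_bound.simps(2)) (simp add: field_simps del: sqrt_bound.simps)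
  ultimately show ?case using * by (simp only:) simp
qed

lemma sqrt_iter_norm_diff:
  fixes C :: "'a::real_normed_vector \<Rightarrow> 'a"
  assumes C: "linear C" "\<And>x. norm (C x) \<le> norm x" and "m \<le> n"
  shows "norm (sqrt_iter C n x - sqrt_iter C m x) \<le> (sqrt_bound n - sqrt_bound m) * norm x"
  using assms(3)
proof (induction n rule: dec_induct)
  case (step n)
  have "norm (sqrt_iter C (Suc n) x - sqrt_iter C m x)
      \<le> norm (sqrt_iter C (Suc n) x - sqrt_iter C n x) + norm (sqrt_iter C n x - sqrt_iter C m x)"
    using norm_triangle_ineq[of "sqrt_iter C (Suc n) x - sqrt_iter C n x"
        "sqrt_iter C n x - sqrt_iter C m x"] by (simp del: sqrt_iter.simps)
  with step.IH sqrt_iter_norm_diff_Suc[OF C, of n x] show ?case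
    by (simp add: algebra_simps del: sqrt_iter.simps sqrt_bound.simps)
qed simp

lemma sqrt_iter_convergent:
  fixes C :: "'a::banach \<Rightarrow> 'a"
  assumes C: "linear C" "\<And>x. norm (C x) \<le> norm x"
  shows "convergent (\<lambda>n. sqrt_iter C n x)"
proof -
  have "convergent sqrt_bound"
    using sqrt_bound_range
    by (intro Bseq_mono_convergent[OF BseqI'[of _ 1]]) (auto intro: monoD[OF sqrt_bound_mono])
  then have "convergent (\<lambda>n. sqrt_bound n * norm x)"
    by (intro convergent_mult convergent_const)
  then have cauchy: "Cauchy (\<lambda>n. sqrt_bound n * norm x)" by (rule convergent_Cauchy)
  have "Cauchy (\<lambda>n. sqrt_iter C n x)"
  proof (rule CauchyI')
    fix e :: real assume "e > 0"
    then obtain M where M: "\<And>m n. m \<ge> M \<Longrightarrow> n \<ge> M \<Longrightarrow>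
        norm (sqrt_bound m * norm x - sqrt_bound n * norm x) < e"
      using CauchyD[OF cauchy] by blast
    have "dist (sqrt_iter C m x) (sqrt_iter C n x) < e" if "m \<ge> M" "m < n" for m n
    proof -
      have "norm (sqrt_iter C n x - sqrt_iter C m x) \<le> (sqrt_bound n - sqrt_bound m) * norm x"
        using that by (intro sqrt_iter_norm_diff[OF C]) simp
      also have "\<dots> < e" using M[of n m] that by (simp add: left_diff_distrib)
      finally show ?thesis by (simp add: dist_norm norm_minus_commute)
    qed
    then show "\<exists>M. \<forall>m\<ge>M. \<forall>n>m. dist (sqrt_iter C m x) (sqrt_iter C n x) < e" by blast
  qed
  then show ?thesis by (rule Cauchy_convergent)
qed

text \<open>The iteration runs on \<open>A / K\<close>, whose bound is 1, and the root is scaled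
  back by \<open>sqrt K\<close>. The commutation clause is recorded for the uniqueness
  proof.\<close>

lemma positive_op_sqrt_exists:
  assumes A: "positive_op A"
  shows "\<exists>S. positive_op S \<and> S \<circ> S = A \<and>
    (\<forall>B. bounded_linear B \<longrightarrow> (\<forall>x. B (A x) = A (B x)) \<longrightarrow> (\<forall>x. B (S x) = S (B x)))"
proof -
  obtain K where K: "0 < K" "\<And>x. norm (A x) \<le> K * norm x"
    using positive_op_pos_bounded[OF A] by blast
  have clA: "bounded_clinear A" and adjA: "\<And>x y. cinner (A x) y = cinner x (A y)"
    using A by (auto simp: positive_op_iff selfadjoint_op_iff)
  have linA: "linear A" by (rule bounded_clinear_linear[OF clA])
  define C where "C x = x - (1/K) *\<^sub>R A x" for x
  have linC: "linear C"
    by (rule linearI) (simp_all add: C_def linear_add[OF linA] linear_scale[OF linA] algebra_simps)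
  \<comment> \<open>In the expansion of the squared norm of \<open>x - (1/K) A x\<close>,
    \<open>positive_op_norm_sq_le\<close> makes the quadratic term at most half of the negative
    cross term.\<close>
  have normC: "norm (C x) \<le> norm x" for x
  proof -
    have pos: "0 \<le> Re (cinner (A x) x)" using A by (simp add: positive_op_iff)
    have "(norm (A x))\<^sup>2 / K\<^sup>2 \<le> (K * Re (cinner (A x) x)) / K\<^sup>2"
      by (intro divide_right_mono positive_op_norm_sq_le[OF A K(2,1)]) simp
    also have "\<dots> = Re (cinner (A x) x) / K" by (simp add: power2_eq_square)
    also have "\<dots> \<le> 2 * (Re (cinner (A x) x) / K)"
      using divide_nonneg_pos[OF pos K(1)] by linarith
    finally have "(norm (C x))\<^sup>2 \<le> (norm x)\<^sup>2"
      using Re_cinner_commute[of x "A x"]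
      by (simp add: C_def norm_diff_sq cinner_simps power_divide)
    then show ?thesis by (rule power2_le_imp_le) simp
  qed
  define Y where "Y x = lim (\<lambda>n. sqrt_iter C n x)" for x
  have Y: "(\<lambda>n. sqrt_iter C n x) \<longlonglongrightarrow> Y x" for x
    unfolding Y_def using sqrt_iter_convergent[OF linC normC] by (simp add: convergent_LIMSEQ_iff)
  have iter_le: "norm (sqrt_iter C n x) \<le> norm x" for n x
    using sqrt_iter_norm_le[OF normC, of n x] sqrt_bound_range[of n]
    by (meson mult_left_le_one_le norm_ge_zero order_trans)
  have normY: "norm (Y x) \<le> norm x" for x
    by (rule LIMSEQ_le_const2[OF tendsto_norm[OF Y]]) (use iter_le in blast)
  \<comment> \<open>Serves twice: with \<open>B\<close> a complex scalar it gives complex linearity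
    of \<open>Y\<close>, and with general \<open>B\<close> the commutation clause.\<close>
  have Y_commute: "B (Y x) = Y (B x)"
    if "bounded_linear B" "\<And>x. B (C x) = C (B x)" for B x
  proof (rule LIMSEQ_unique)
    show "(\<lambda>n. B (sqrt_iter C n x)) \<longlonglongrightarrow> B (Y x)"
      by (rule bounded_linear.tendsto[OF that(1) Y])
    show "(\<lambda>n. B (sqrt_iter C n x)) \<longlonglongrightarrow> Y (B x)"
      using Y[of "B x"] by (simp add: sqrt_iter_commute bounded_linear.linear that)
  qed
  have Y_add: "Y (x + y) = Y x + Y y" for x y
    by (rule LIMSEQ_unique[OF Y])
      (use tendsto_add[OF Y Y] in \<open>simp add: linear_add[OF sqrt_iter_linear[OF linC]]\<close>)
  have Y_scaleC: "Y (c *\<^sub>C x) = c *\<^sub>C Y x" for c x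
    by (rule Y_commute[OF bounded_linear_scaleC, symmetric])
      (simp add: C_def scaleC_right_diff_distrib bounded_clinear_scaleC[OF clA] scaleC_scaleR_commute)
  have Y_scaleR: "Y (r *\<^sub>R x) = r *\<^sub>R Y x" for r x by (simp add: scaleR_scaleC Y_scaleC)
  have Y_diff: "Y (x - y) = Y x - Y y" for x y
    using Y_add[of x "- y"] Y_scaleR[of "-1" y] by simp
  have Y_cinner: "cinner (Y x) y = cinner x (Y y)" for x y
  proof (rule LIMSEQ_unique)
    show "(\<lambda>n. cinner (sqrt_iter C n x) y) \<longlonglongrightarrow> cinner (Y x) y"
      by (rule bounded_linear.tendsto[OF bounded_linear_cinner_left Y])
    \<comment> \<open>Continuity is available in the first argument, so the limit in the second one
      is taken after conjugation.\<close>
    have "(\<lambda>n. cnj (cinner (sqrt_iter C n y) x)) \<longlonglongrightarrow> cnj (cinner (Y y) x)"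
      by (intro tendsto_cnj bounded_linear.tendsto[OF bounded_linear_cinner_left Y])
    moreover have "cinner (C x) y = cinner x (C y)" for x y
      by (simp add: C_def cinner_simps adjA)
    ultimately show "(\<lambda>n. cinner (sqrt_iter C n x) y) \<longlonglongrightarrow> cinner x (Y y)"
      by (simp add: sqrt_iter_cinner flip: cinner_commute)
  qed
  \<comment> \<open>Both the operator and its argument vary. Splitting off
    \<open>sqrt_iter C n (Y x)\<close> leaves the iterate at \<open>sqrt_iter C n x - Y x\<close>,
    which tends to 0 since all iterates are contractions.\<close>
  have "(\<lambda>n. sqrt_iter C n (sqrt_iter C n x)) \<longlonglongrightarrow> Y (Y x)" for x
  proof -
    have "(\<lambda>n. norm (sqrt_iter C n x - Y x)) \<longlonglongrightarrow> 0"
      using Y[of x] by (simp add: LIM_zero_iff tendsto_norm_zero)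
    then have "(\<lambda>n. sqrt_iter C n (sqrt_iter C n x - Y x)) \<longlonglongrightarrow> 0"
      by (rule Lim_null_comparison[rotated]) (simp add: iter_le)
    from tendsto_add[OF this Y[of "Y x"]] show ?thesis
      by (simp add: linear_diff[OF sqrt_iter_linear[OF linC]])
  qed
  then have "(\<lambda>n. sqrt_iter C (Suc n) x) \<longlonglongrightarrow> (1/2) *\<^sub>R (C x + Y (Y x))" for x
    unfolding sqrt_iter.simps by (intro tendsto_intros)
  then have "Y x = (1/2) *\<^sub>R (C x + Y (Y x))" for x
    by (rule LIMSEQ_unique[OF LIMSEQ_Suc[OF Y]])
  then have "2 *\<^sub>R Y x = 2 *\<^sub>R ((1/2) *\<^sub>R (C x + Y (Y x)))" for x
    by (rule arg_cong)
  then have YY: "Y (Y x) = 2 *\<^sub>R Y x - C x" for x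
    unfolding scaleR_scaleR by simp
  define S where "S x = sqrt K *\<^sub>R (x - Y x)" for x
  have "bounded_clinear S"
  proof -
    have "bounded_linear Y"
      by (rule bounded_linear_intro[where K = 1]) (simp_all add: Y_add Y_scaleR normY)
    then have "bounded_linear S"
      unfolding S_def
      by (intro bounded_linear_compose[OF bounded_linear_scaleR_right] bounded_linear_sub
          bounded_linear_ident)
    then show ?thesis
      by (simp add: bounded_clinear_def S_def Y_scaleC scaleC_scaleR_commute
          scaleC_right_diff_distrib del: scaleR_diff_right)
  qed
  \<comment> \<open>\<open>Y\<close> is a contraction, so the form of \<open>1 - Y\<close> is
    nonnegative.\<close>
  moreover have "0 \<le> Re (cinner (S x) x)" for x
  proof -
    have "Re (cinner (Y x) x) \<le> norm (Y x) * norm x" by (rule Re_cinner_le)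
    also have "\<dots> \<le> norm x * norm x" by (intro mult_right_mono normY) simp
    finally show ?thesis
      using K(1) by (simp add: S_def cinner_simps cinner_self power2_eq_square zero_le_mult_iff
          right_diff_distrib[symmetric])
  qed
  ultimately have "positive_op S"
    by (simp add: positive_op_iff selfadjoint_op_iff S_def cinner_simps Y_cinner)
  moreover have "S \<circ> S = A"
  proof
    fix x
    have "S (S x) = (sqrt K * sqrt K) *\<^sub>R (x - Y x - (Y x - Y (Y x)))"
      by (simp only: S_def Y_scaleR Y_diff flip: scaleR_diff_right scaleR_scaleR)
    also have "\<dots> = K *\<^sub>R (x - C x)"
      using K(1) by (simp add: YY scaleR_2 algebra_simps)
    also have "\<dots> = A x" using K(1) by (simp add: C_def)
    finally show "(S \<circ> S) x = A x" by simp
  qed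
  moreover have "B (S x) = S (B x)" if "bounded_linear B" "\<And>x. B (A x) = A (B x)" for B x
  proof -
    have l: "linear B" using that(1) by (rule bounded_linear.linear)
    have "B (Y x) = Y (B x)"
      by (rule Y_commute) (simp_all add: that C_def linear_diff[OF l] linear_scale[OF l])
    then show ?thesis by (simp add: S_def linear_diff[OF l] linear_scale[OF l])
  qed
  ultimately show ?thesis by blast
qed

text \<open>If \<open>S\<close> is the constructed root and \<open>B\<close> another one, they commute, so \<open>D = B - S\<close> satisfies
  \<open>(B + S) D = 0\<close>; positivity forces \<open>B D = S D = 0\<close> and hence \<open>D\<^sup>2 = 0\<close>.\<close>

lemma op_sqrt_eqI:
  assumes A: "positive_op A" and B: "positive_op B" "B \<circ> B = A"
  shows "op_sqrt A = B"
proof -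
  obtain S where S: "positive_op S" "S \<circ> S = A"
    and commute: "\<And>B x. bounded_linear B \<Longrightarrow> (\<And>x. B (A x) = A (B x)) \<Longrightarrow> B (S x) = S (B x)"
    using positive_op_sqrt_exists[OF A] by blast
  have unique: "B = S" if B: "positive_op B" "B \<circ> B = A" for B
  proof
    fix x
    have saB: "selfadjoint_op B" and saS: "selfadjoint_op S"
      using B S by (simp_all add: positive_op_iff)
    then have clB: "bounded_clinear B" and clS: "bounded_clinear S"
      by (simp_all add: selfadjoint_op_iff)
    note lB = bounded_clinear_linear[OF clB] and lS = bounded_clinear_linear[OF clS]
    have BB: "B (B z) = A z" and SS: "S (S z) = A z" for z
      using B(2) S(2) by (simp_all add: fun_eq_iff)
    \<comment> \<open>\<open>B\<close> commutes with its own square \<open>A\<close>, hence with the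
      constructed root.\<close>
    have BS: "B (S z) = S (B z)" for z
      by (rule commute) (simp_all add: bounded_clinear_bounded_linear[OF clB] flip: BB)
    define d where "d = B x - S x"
    have "B d + S d = 0"
      by (simp add: d_def linear_diff[OF lB] linear_diff[OF lS] BB SS BS)
    then have "Re (cinner (B d) d) + Re (cinner (S d) d) = 0"
      by (simp add: cinner_zero_left flip: plus_complex.sel(1) cinner_add_left)
    moreover have "0 \<le> Re (cinner (B d) d)" "0 \<le> Re (cinner (S d) d)"
      using B(1) S(1) by (simp_all add: positive_op_iff)
    ultimately have "Re (cinner (B d) d) = 0" "Re (cinner (S d) d) = 0" by linarith+
    then have "B d = 0" "S d = 0" using positive_op_eq_0 B(1) S(1) by blast+
    \<comment> \<open>Writing one factor as \<open>B x - S x\<close> and moving \<open>B\<close> and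
      \<open>S\<close> across expresses the squared norm through \<open>B d\<close> and
      \<open>S d\<close>.\<close>
    moreover have "cinner d d = cinner x (B d) - cinner x (S d)"
      by (subst d_def) (simp add: cinner_simps selfadjoint_op_cinner[OF saB]
          selfadjoint_op_cinner[OF saS])
    ultimately have "cinner d d = 0" by (simp add: cinner_simps)
    then show "B x = S x" by (simp add: cinner_self_eq_0_iff d_def)
  qed
  show ?thesis
    unfolding op_sqrt_def
  proof (rule the_equality)
    fix B' assume "positive_op B' \<and> B' \<circ> B' = A"
    then have "B' = S" by (intro unique) simp_all
    then show "B' = B" using unique[OF B] by simp
  qed (use B in simp)
qed

lemma op_sqrt_positive:
  assumes A: "positive_op A"
  shows "positive_op (op_sqrt A)" "op_sqrt A \<circ> op_sqrt A = A"
  using positive_op_sqrt_exists[OF A] op_sqrt_eqI[OF A] by auto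

section \<open>Real multiples of partial isometries\<close>

lemma selfadjoint_op_scaleR:
  "selfadjoint_op T \<Longrightarrow> selfadjoint_op (\<lambda>x. r *\<^sub>R T x)"
  by (simp add: selfadjoint_op_iff bounded_clinear_scaleR cinner_simps)

lemma orthogonal_projection_positive:
  assumes "orthogonal_projection P"
  shows "positive_op P"
proof -
  have sa: "selfadjoint_op P" and PP: "P (P x) = P x" for x
    using assms by (simp_all add: orthogonal_projection_def fun_eq_iff)
  have "cinner (P x) x = cinner (P x) (P x)" for x
    by (metis PP sa selfadjoint_op_cinner)
  then show ?thesis using sa by (simp add: positive_op_iff cinner_self)
qed

text \<open>Idempotence and symmetry make the squared norm of \<open>P x\<close> equal to
  \<open>cinner (P x) x\<close>; Cauchy-Schwarz then allows one factor to be cancelled.\<close>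

lemma orthogonal_projection_norm_le:
  assumes "orthogonal_projection P"
  shows "norm (P x) \<le> norm x"
proof (cases "P x = 0")
  case False
  have sa: "selfadjoint_op P" and PP: "P (P x) = P x"
    using assms by (simp_all add: orthogonal_projection_def fun_eq_iff)
  have "Re (cinner (P x) (P x)) = Re (cinner (P x) x)"
    by (metis PP sa selfadjoint_op_cinner)
  then have "(norm (P x))\<^sup>2 \<le> norm (P x) * norm x"
    using Re_cinner_le[of "P x" x] by (simp add: cinner_self)
  then show ?thesis using False by (simp add: power2_eq_square)
qed simp

theorem corollary3p2:
  fixes T T0 :: "'a::complex_hilbert_space \<Rightarrow> 'a" and \<alpha> :: real
  assumes "bounded_clinear T"
    and "partial_isometry T0"
    and "T = (\<lambda>x. \<alpha> *\<^sub>R T0 x)"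
    and "op_le (op_abs T) (op_abs (op_Re T))"
  shows "selfadjoint_op T"
proof -
  note T = assms(1)
  define P where "P = cadjoint T0 \<circ> T0"
  have V: "bounded_clinear T0" and P: "orthogonal_projection P"
    using assms(2) by (simp_all add: partial_isometry_def P_def)
  have saP: "selfadjoint_op P" and PP: "P (P x) = P x" for x
    using P by (simp_all add: orthogonal_projection_def fun_eq_iff)
  have linP: "linear P" using saP by (simp add: selfadjoint_op_iff bounded_clinear_linear)
  have linV: "linear T0" by (rule bounded_clinear_linear[OF V])
  have norm_V_sq: "(norm (T0 x))\<^sup>2 = Re (cinner (P x) x)" for x
    by (simp add: P_def cinner_cadjoint'[OF V] cinner_self)
  \<comment> \<open>\<open>x - P x\<close> lies in the kernel of \<open>P\<close>, and
    \<open>norm_V_sq\<close> shows that \<open>T0\<close> vanishes there.\<close>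
  have "T0 (x - P x) = 0" for x
    using norm_V_sq[of "x - P x"] by (simp add: linear_diff[OF linP] PP cinner_zero_left)
  then have VP: "T0 (P x) = T0 x" for x by (simp add: linear_diff[OF linV])
  \<comment> \<open>The factor 1 is written out to play the role of \<open>K\<close> in
    \<open>norm_cadjoint_le\<close>.\<close>
  have norm_V: "norm (T0 x) \<le> 1 * norm x" for x
  proof -
    have "(norm (T0 x))\<^sup>2 \<le> norm (P x) * norm x" unfolding norm_V_sq by (rule Re_cinner_le)
    also have "\<dots> \<le> norm x * norm x"
      by (intro mult_right_mono orthogonal_projection_norm_le P) simp
    finally have "(norm (T0 x))\<^sup>2 \<le> (norm x)\<^sup>2" by (simp add: power2_eq_square)
    then show ?thesis by simp
  qed
  have norm_V': "norm (cadjoint T0 x) \<le> norm x" for x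
    using norm_cadjoint_le[OF V norm_V] by simp
  have adjT: "cadjoint T = (\<lambda>x. \<alpha> *\<^sub>R cadjoint T0 x)"
    by (rule cadjoint_eqI) (simp add: assms(3) cinner_simps cinner_cadjoint[OF V])
  have linV': "linear (cadjoint T0)"
    by (rule bounded_clinear_linear[OF bounded_clinear_cadjoint[OF V]])
  \<comment> \<open>Uniqueness of the root: the candidate squares to
    \<open>\<alpha>\<^sup>2 P\<close>, and the absolute value makes it positive for either sign of
    \<alpha>.\<close>
  have abs_T: "op_abs T = (\<lambda>x. \<bar>\<alpha>\<bar> *\<^sub>R P x)"
    unfolding op_abs_def
  proof (rule op_sqrt_eqI[OF positive_op_cadjoint_comp[OF T]])
    show "positive_op (\<lambda>x. \<bar>\<alpha>\<bar> *\<^sub>R P x)"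
      by (intro positive_op_scaleR orthogonal_projection_positive P) simp
    show "(\<lambda>x. \<bar>\<alpha>\<bar> *\<^sub>R P x) \<circ> (\<lambda>x. \<bar>\<alpha>\<bar> *\<^sub>R P x) = cadjoint T \<circ> T"
      unfolding adjT unfolding assms(3)
      by (simp add: fun_eq_iff linear_scale[OF linP] PP linear_scale[OF linV'])
        (simp add: P_def)
  qed
  let ?R = "op_Re T"
  define B where "B = op_abs ?R"
  have saR: "selfadjoint_op ?R" by (rule selfadjoint_op_Re[OF T])
  then have clR: "bounded_clinear ?R" and adjR: "cadjoint ?R = ?R"
    by (simp_all add: selfadjoint_op_def)
  have "positive_op B" and BB: "B \<circ> B = ?R \<circ> ?R"
    unfolding B_def op_abs_def
    using op_sqrt_positive[OF positive_op_cadjoint_comp[OF clR]] by (simp_all add: adjR)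
  then have saB: "selfadjoint_op B" by (simp add: positive_op_iff)
  \<comment> \<open>\<open>B\<close> and \<open>Re T\<close> are self-adjoint with equal squares.
    This lets Cauchy-Schwarz for \<open>B\<close> produce a bound in \<open>Re T\<close>
    itself.\<close>
  have norm_B: "norm (B x) = norm (?R x)" for x
  proof -
    have "cinner (B x) (B x) = cinner (?R x) (?R x)"
      using BB by (simp add: selfadjoint_op_cinner[OF saB] selfadjoint_op_cinner[OF saR] fun_eq_iff)
    then show ?thesis by (simp add: norm_eq_sqrt_cinner)
  qed
  have le: "Re (cinner (\<bar>\<alpha>\<bar> *\<^sub>R P x) x) \<le> Re (cinner (B x) x)" for x
    using assms(4) by (simp add: op_le_def abs_T positive_op_iff cinner_simps flip: B_def)
  show ?thesis
  proof (cases "\<alpha> = 0")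
    case True
    then show ?thesis using T by (simp add: selfadjoint_op_iff assms(3) cinner_simps)
  next
    case False
    have eq_on_range: "T0 x = cadjoint T0 x" if Px: "P x = x" for x
    proof -
      have "\<bar>\<alpha>\<bar> * (norm x)\<^sup>2 \<le> Re (cinner (B x) x)"
        using le[of x] Px by (simp add: cinner_simps cinner_self)
      also have "\<dots> \<le> norm (?R x) * norm x"
        using Re_cinner_le[of "B x" x] by (simp add: norm_B)
      also have "?R x = (\<alpha> / 2) *\<^sub>R (T0 x + cadjoint T0 x)"
        unfolding op_Re_def adjT unfolding assms(3) by (simp add: scaleR_add_right)
      finally have "\<bar>\<alpha>\<bar> * (2 * (norm x)\<^sup>2) \<le> \<bar>\<alpha>\<bar> * (norm (T0 x + cadjoint T0 x) * norm x)"
        unfolding norm_scaleR by simp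
      then have "norm x * (2 * norm x) \<le> norm x * norm (T0 x + cadjoint T0 x)"
        using False by (simp add: power2_eq_square mult_ac)
      then have "2 * norm x \<le> norm (T0 x + cadjoint T0 x)"
        by (cases "x = 0") simp_all
      then have "(2 * norm x)\<^sup>2 \<le> (norm (T0 x + cadjoint T0 x))\<^sup>2"
        by (rule power_mono) simp
      then have "4 * (norm x)\<^sup>2 \<le> (norm (T0 x + cadjoint T0 x))\<^sup>2"
        by (simp add: power_mult_distrib)
      moreover have "(norm (T0 x))\<^sup>2 \<le> (norm x)\<^sup>2" "(norm (cadjoint T0 x))\<^sup>2 \<le> (norm x)\<^sup>2"
        using norm_V[of x] norm_V'[of x] by (simp_all add: power_mono)
      \<comment> \<open>The two images have norm at most \<open>norm x\<close> while their sum has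
        norm at least \<open>2 * norm x\<close>, so the parallelogram law leaves nothing for the
        difference.\<close>
      ultimately have "(norm (T0 x - cadjoint T0 x))\<^sup>2 \<le> 0"
        using parallelogram_law[of "T0 x" "cadjoint T0 x"]
        by linarith
      then show ?thesis by simp
    qed
    have V_eq: "T0 x = cadjoint T0 (P x)" for x
      using eq_on_range[of "P x"] by (simp add: PP VP)
    \<comment> \<open>The adjoint of the identity \<open>V_eq\<close>, obtained by testing against
      \<open>z\<close>.\<close>
    have adj_eq: "cadjoint T0 y = P (T0 y)" for y
    proof (rule cinner_left_eqI)
      fix z
      have "cinner z (cadjoint T0 y) = cinner (cadjoint T0 (P z)) y"
        by (simp add: V_eq flip: cinner_cadjoint[OF V])
      also have "\<dots> = cinner z (P (T0 y))"
        by (simp add: cinner_cadjoint'[OF V] selfadjoint_op_cinner[OF saP])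
      finally show "cinner z (cadjoint T0 y) = cinner z (P (T0 y))" .
    qed
    have "cadjoint T0 y = T0 y" for y
    proof -
      have "cadjoint T0 y = P (T0 (P y))" by (simp only: adj_eq VP)
      also have "\<dots> = cadjoint T0 (P y)" by (rule adj_eq[symmetric])
      also have "\<dots> = T0 y" by (rule V_eq[symmetric])
      finally show ?thesis .
    qed
    then have "cadjoint T0 = T0" by (rule ext)
    then have "selfadjoint_op T0" using V by (simp add: selfadjoint_op_def)
    then show ?thesis unfolding assms(3) by (rule selfadjoint_op_scaleR)
  qed
qed

end
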